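(* Let $X$ be a separable Banach space, $\Lambda$ a metric space and $\lambda_0\in\Lambda$. For each $\lambda\in\Lambda$ let $\Phi_\lambda$ be a continuous cocycle on $X$ over $(\Omega_1,\{\theta_{1,t}\}_{t\in\mathbb R})$ and $(\Omega_2,\mathcal F_2,P,\{\theta_{2,t}\}_{t\in\mathbb R})$, let $\mathcal D_\lambda$ be a collection of families $\{D(\omega_1,\omega_2)\}_{\omega_1\in\Omega_1,\omega_2\in\Omega_2}$ of nonempty subsets of $X$, and suppose $\Phi_\lambda$ has a $\mathcal D_\lambda$-pullback attractor $\mathcal A_\lambda\in\mathcal D_\lambda$ and a $\mathcal D_\lambda$-pullback absorbing set $K_\lambda\in\mathcal D_\lambda$. Assume: (1) for every $t\in\mathbb R^+$, $\omega_1\in\Omega_1$, $\omega_2\in\Omega_2$, every sequence $\lambda_n\to\lambda_0$ in $\Lambda$ and every $x_n\to x$ in $X$, $\lim_{n\to\infty}\Phi_{\lambda_n}(t,\omega_1,\omega_2,x_n)=\Phi_{\lambda_0}(t,\omega_1,\omega_2,x)$; (2) there is a map $R_{\lambda_0}:\Omega_1\times\Omega_2\to\mathbb R$ such that the family $B=\{B(\omega_1,\omega_2)=\{x\in X:\|x\|_X\le R_{\lambda_0}(\omega_1,\omega_2)\}:\omega_1\in\Omega_1,\omega_2\in\Omega_2\}$ belongs to $\mathcal D_{\lambda_0}$; (3) for all $\omega_1\in\Omega_1$, $\omega_2\in\Omega_2$, $\limsup_{\lambda\to\lambda_0}\|K_\lambda(\omega_1,\omega_2)\|_X\le R_{\lambda_0}(\omega_1,\omega_2)$,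 where $\|S\|_X=\sup_{x\in S}\|x\|_X$ for $S\subseteq X$; (4) for every $\omega_1\in\Omega_1$, $\omega_2\in\Omega_2$, the set $\bigcup_{\lambda\in\Lambda}\mathcal A_\lambda(\omega_1,\omega_2)$ is precompact in $X$. Then for every $\omega_1\in\Omega_1$ and $\omega_2\in\Omega_2$, $\mathrm{dist}(\mathcal A_\lambda(\omega_1,\omega_2),\mathcal A_{\lambda_0}(\omega_1,\omega_2))\to0$ as $\lambda\to\lambda_0$.
   Context: $\mathrm{dist}(A,B)=\sup_{a\in A}\inf_{b\in B}\|a-b\|_X$ is the Hausdorff semi-distance. Parametric dynamical systems: $\Omega_1$ is a nonempty set and $\theta_{1,t}:\Omega_1\to\Omega_1$ ($t\in\mathbb R$) satisfy $\theta_{1,0}=\mathrm{id}$, $\theta_{1,s+t}=\theta_{1,t}\circ\theta_{1,s}$. $(\Omega_2,\mathcal F_2,P)$ is a probability space and $(t,\omega_2)\mapsto\theta_{2,t}\omega_2$ is $(\mathcal B(\mathbb R)\times\mathcal F_2,\mathcal F_2)$-measurable with $\theta_{2,0}=\mathrm{id}$, $\theta_{2,s+t}=\theta_{2,t}\circ\theta_{2,s}$ and $P\theta_{2,t}=P$. A continuous cocycle on $X$ over these systems is a map $\Phi:\mathbb R^+\times\Omega_1\times\Omega_2\times X\to X$ such that for all $\omega_1,\omega_2$ and $t,\tau\in\mathbb R^+$: (i) $\Phi(\cdot,\omega_1,\cdot,\cdot)$ is $(\mathcal B(\mathbb R^+)\times\mathcal F_2\times\mathcal B(X),\mathcal B(X))$-measurable;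 (ii) $\Phi(0,\omega_1,\omega_2,\cdot)=\mathrm{id}$; (iii) $\Phi(t+\tau,\omega_1,\omega_2,\cdot)=\Phi(t,\theta_{1,\tau}\omega_1,\theta_{2,\tau}\omega_2,\cdot)\circ\Phi(\tau,\omega_1,\omega_2,\cdot)$; (iv) $\Phi(t,\omega_1,\omega_2,\cdot):X\to X$ is continuous. For a collection $\mathcal D$ of families of nonempty subsets of $X$ indexed by $\Omega_1\times\Omega_2$: $K\in\mathcal D$ is a $\mathcal D$-pullback absorbing set for $\Phi$ if for all $\omega_1,\omega_2$ and every $B\in\mathcal D$ there is $T=T(B,\omega_1,\omega_2)>0$ with $\Phi(t,\theta_{1,-t}\omega_1,\theta_{2,-t}\omega_2,B(\theta_{1,-t}\omega_1,\theta_{2,-t}\omega_2))\subseteq K(\omega_1,\omega_2)$ for all $t\ge T$. $\mathcal A\in\mathcal D$ is a $\mathcal D$-pullback attractor for $\Phi$ if: (i) each $\mathcal A(\omega_1,\omega_2)$ is compact, and $\mathcal A$ is measurable with respect to the $P$-completion of $\mathcal F_2$ in $\Omega_2$ (i.e. $\omega_2\mapsto d(x,\mathcal A(\omega_1,\omega_2))$ is measurable for every $x\in X$ and $\omega_1\in\Omega_1$); (ii) $\Phi(t,\omega_1,\omega_2,\mathcal A(\omega_1,\omega_2))=\mathcal A(\theta_{1,t}\omega_1,\theta_{2,t}\omega_2)$ for all $t\ge0$; (iii) for every $B\in\mathcal D$ and all $\omega_1,\omega_2$, $\lim_{t\to\infty}\mathrm{dist}(\Phi(t,\theta_{1,-t}\omega_1,\theta_{2,-t}\omega_2,B(\theta_{1,-t}\omega_1,\theta_{2,-t}\omega_2)),\mathcal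 A(\omega_1,\omega_2))=0$. *)

theory Defs
  imports "HOL-Probability.Probability_Measure"
begin

text \<open>Extended-real valued, since the left-hand set may be unbounded. All sets to which this is
  applied are nonempty.\<close>

definition hausdorff_semidist :: "'x::real_normed_vector set \<Rightarrow> 'x set \<Rightarrow> ereal" where
  "hausdorff_semidist A B = (SUP a\<in>A. INF b\<in>B. ereal (norm (a - b)))"

definition set_norm :: "'x::real_normed_vector set \<Rightarrow> ereal" where
  "set_norm S = (SUP x\<in>S. ereal (norm x))"

definition parametric_flow :: "'a set \<Rightarrow> (real \<Rightarrow> 'a \<Rightarrow> 'a) \<Rightarrow> bool" where
  "parametric_flow \<Omega> \<theta> \<longleftrightarrow>
     \<Omega> \<noteq> {} \<and>
     (\<forall>t. \<theta> t \<in> \<Omega> \<rightarrow> \<Omega>) \<and>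
     (\<forall>\<omega>\<in>\<Omega>. \<theta> 0 \<omega> = \<omega>) \<and>
     (\<forall>s t. \<forall>\<omega>\<in>\<Omega>. \<theta> (s + t) \<omega> = \<theta> t (\<theta> s \<omega>))"

definition measurable_flow :: "'b measure \<Rightarrow> (real \<Rightarrow> 'b \<Rightarrow> 'b) \<Rightarrow> bool" where
  "measurable_flow P \<theta> \<longleftrightarrow>
     prob_space P \<and>
     parametric_flow (space P) \<theta> \<and>
     (\<lambda>(t, \<omega>). \<theta> t \<omega>) \<in> measurable (borel \<Otimes>\<^sub>M P) P \<and>
     (\<forall>t. distr P P (\<theta> t) = P)"

text \<open>Time ranges over the nonnegative reals; the values of \<open>\<Phi>\<close> at negative times, and at
  parameters outside \<open>\<Omega>1\<close> and \<open>space P\<close>, are irrelevant.\<close>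

definition continuous_cocycle ::
  "'a set \<Rightarrow> (real \<Rightarrow> 'a \<Rightarrow> 'a) \<Rightarrow> 'b measure \<Rightarrow> (real \<Rightarrow> 'b \<Rightarrow> 'b) \<Rightarrow>
   (real \<Rightarrow> 'a \<Rightarrow> 'b \<Rightarrow> 'x::real_normed_vector \<Rightarrow> 'x) \<Rightarrow> bool" where
  "continuous_cocycle \<Omega>1 \<theta>1 P \<theta>2 \<Phi> \<longleftrightarrow>
     (\<forall>\<omega>1\<in>\<Omega>1. (\<lambda>(t, \<omega>2, x). \<Phi> t \<omega>1 \<omega>2 x)
        \<in> measurable (restrict_space borel {0..} \<Otimes>\<^sub>M (P \<Otimes>\<^sub>M borel)) borel) \<and>
     (\<forall>\<omega>1\<in>\<Omega>1. \<forall>\<omega>2\<in>space P. \<Phi> 0 \<omega>1 \<omega>2 = id) \<and>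
     (\<forall>\<omega>1\<in>\<Omega>1. \<forall>\<omega>2\<in>space P. \<forall>t\<ge>0. \<forall>\<tau>\<ge>0.
        \<Phi> (t + \<tau>) \<omega>1 \<omega>2 = \<Phi> t (\<theta>1 \<tau> \<omega>1) (\<theta>2 \<tau> \<omega>2) \<circ> \<Phi> \<tau> \<omega>1 \<omega>2) \<and>
     (\<forall>\<omega>1\<in>\<Omega>1. \<forall>\<omega>2\<in>space P. \<forall>t\<ge>0. continuous_on UNIV (\<Phi> t \<omega>1 \<omega>2))"

text \<open>Families are extensional functions on \<open>\<Omega>1 \<times> \<Omega>2\<close>, so that membership of a family in a
  collection depends only on its values on \<open>\<Omega>1 \<times> \<Omega>2\<close>.\<close>

definition nonempty_families :: "'a set \<Rightarrow> 'b set \<Rightarrow> ('a \<times> 'b \<Rightarrow> 'x set) set" where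
  "nonempty_families \<Omega>1 \<Omega>2 = (\<Omega>1 \<times> \<Omega>2 \<rightarrow>\<^sub>E {S. S \<noteq> {}})"

definition pullback_absorbing ::
  "'a set \<Rightarrow> (real \<Rightarrow> 'a \<Rightarrow> 'a) \<Rightarrow> 'b measure \<Rightarrow> (real \<Rightarrow> 'b \<Rightarrow> 'b) \<Rightarrow>
   (real \<Rightarrow> 'a \<Rightarrow> 'b \<Rightarrow> 'x \<Rightarrow> 'x) \<Rightarrow> ('a \<times> 'b \<Rightarrow> 'x set) set \<Rightarrow>
   ('a \<times> 'b \<Rightarrow> 'x set) \<Rightarrow> bool" where
  "pullback_absorbing \<Omega>1 \<theta>1 P \<theta>2 \<Phi> \<D> K \<longleftrightarrow>
     K \<in> \<D> \<and>
     (\<forall>\<omega>1\<in>\<Omega>1. \<forall>\<omega>2\<in>space P. \<forall>B\<in>\<D>. \<exists>T>0. \<forall>t\<ge>T.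
        \<Phi> t (\<theta>1 (- t) \<omega>1) (\<theta>2 (- t) \<omega>2) ` B (\<theta>1 (- t) \<omega>1, \<theta>2 (- t) \<omega>2) \<subseteq> K (\<omega>1, \<omega>2))"

definition pullback_attractor ::
  "'a set \<Rightarrow> (real \<Rightarrow> 'a \<Rightarrow> 'a) \<Rightarrow> 'b measure \<Rightarrow> (real \<Rightarrow> 'b \<Rightarrow> 'b) \<Rightarrow>
   (real \<Rightarrow> 'a \<Rightarrow> 'b \<Rightarrow> 'x::real_normed_vector \<Rightarrow> 'x) \<Rightarrow> ('a \<times> 'b \<Rightarrow> 'x set) set \<Rightarrow>
   ('a \<times> 'b \<Rightarrow> 'x set) \<Rightarrow> bool" where
  "pullback_attractor \<Omega>1 \<theta>1 P \<theta>2 \<Phi> \<D> A \<longleftrightarrow>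
     A \<in> \<D> \<and>
     (\<forall>\<omega>1\<in>\<Omega>1. \<forall>\<omega>2\<in>space P. compact (A (\<omega>1, \<omega>2))) \<and>
     (\<forall>x. \<forall>\<omega>1\<in>\<Omega>1. (\<lambda>\<omega>2. infdist x (A (\<omega>1, \<omega>2))) \<in> borel_measurable (completion P)) \<and>
     (\<forall>\<omega>1\<in>\<Omega>1. \<forall>\<omega>2\<in>space P. \<forall>t\<ge>0.
        \<Phi> t \<omega>1 \<omega>2 ` A (\<omega>1, \<omega>2) = A (\<theta>1 t \<omega>1, \<theta>2 t \<omega>2)) \<and>
     (\<forall>B\<in>\<D>. \<forall>\<omega>1\<in>\<Omega>1. \<forall>\<omega>2\<in>space P.
        ((\<lambda>t. hausdorff_semidist
            (\<Phi> t (\<theta>1 (- t) \<omega>1) (\<theta>2 (- t) \<omega>2) ` B (\<theta>1 (- t) \<omega>1, \<theta>2 (- t) \<omega>2))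
            (A (\<omega>1, \<omega>2))) \<longlongrightarrow> 0) at_top)"

end

theory Submission
  imports Defs
begin

text \<open>A limit \<open>x\<close> of points \<open>x\<^sub>n \<in> A\<^bsub>\<lambda>\<^sub>n\<^esub>(\<omega>)\<close> with \<open>\<lambda>\<^sub>n \<rightarrow> \<lambda>\<^sub>0\<close> can be pulled back by any time \<open>t \<ge> 0\<close>:
  by invariance \<open>x\<^sub>n\<close> is the image of some \<open>y\<^sub>n \<in> A\<^bsub>\<lambda>\<^sub>n\<^esub>(\<theta>\<^bsub>-t\<^esub> \<omega>)\<close>, and by precompactness a subsequence
  of the \<open>y\<^sub>n\<close> converges to some \<open>y\<close> with \<open>x = \<Phi>\<^bsub>\<lambda>\<^sub>0\<^esub>(t, \<theta>\<^bsub>-t\<^esub> \<omega>, y)\<close>. Since attractors lie in absorbing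
  sets, the bound on the limsup of the norms forces \<open>y\<close> into the ball of radius \<open>R(\<theta>\<^bsub>-t\<^esub> \<omega>)\<close>. That family of
  balls is attracted by \<open>A\<^bsub>\<lambda>\<^sub>0\<^esub>\<close>, so \<open>x\<close> is arbitrarily close to \<open>A\<^bsub>\<lambda>\<^sub>0\<^esub>(\<omega>)\<close>. A subsequence of points
  staying away from \<open>A\<^bsub>\<lambda>\<^sub>0\<^esub>(\<omega>)\<close> is therefore impossible.\<close>

lemma parametric_flow_in:
  assumes "parametric_flow \<Omega> \<theta>" "\<omega> \<in> \<Omega>"
  shows "\<theta> t \<omega> \<in> \<Omega>"
  using assms unfolding parametric_flow_def by blast

lemma parametric_flow_cancel:
  assumes "parametric_flow \<Omega> \<theta>" "\<omega> \<in> \<Omega>"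
  shows "\<theta> t (\<theta> (- t) \<omega>) = \<omega>"
proof -
  have "\<theta> (- t + t) \<omega> = \<theta> t (\<theta> (- t) \<omega>)" "\<theta> 0 \<omega> = \<omega>"
    using assms unfolding parametric_flow_def by blast+
  then show ?thesis by simp
qed

lemma norm_le_set_norm: "x \<in> S \<Longrightarrow> ereal (norm x) \<le> set_norm S"
  unfolding set_norm_def by (rule SUP_upper)

text \<open>Nonemptiness of \<open>A\<close> matters because the supremum over the empty set in
  \<open>ereal\<close> is minus infinity. An empty \<open>B\<close> is harmless: the infimum is then
  plus infinity.\<close>

lemma hausdorff_semidist_nonneg:
  assumes "A \<noteq> {}"
  shows "0 \<le> hausdorff_semidist A B"
proof -
  obtain a where "a \<in> A" using assms by blast
  have "0 \<le> (INF b\<in>B. ereal (norm (a - b)))"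
    by (rule INF_greatest) simp
  also have "\<dots> \<le> hausdorff_semidist A B"
    unfolding hausdorff_semidist_def using \<open>a \<in> A\<close> by (rule SUP_upper)
  finally show ?thesis .
qed

lemma hausdorff_semidist_lessD:
  assumes "hausdorff_semidist A B < ereal e" "a \<in> A"
  obtains b where "b \<in> B" "norm (a - b) < e"
proof -
  have "(INF b\<in>B. ereal (norm (a - b))) \<le> hausdorff_semidist A B"
    unfolding hausdorff_semidist_def using assms(2) by (rule SUP_upper)
  also have "\<dots> < ereal e" by fact
  finally show ?thesis using that by (auto simp: INF_less_iff)
qed

text \<open>A value below the supremum is already exceeded by one point \<open>a\<close>, whose
  distance to all of \<open>B\<close> is then uniformly larger than \<open>e\<close>.\<close>

lemma less_hausdorff_semidistD:
  assumes "ereal e < hausdorff_semidist A B"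
  obtains a where "a \<in> A" "\<And>b. b \<in> B \<Longrightarrow> e < norm (a - b)"
proof -
  obtain a where a: "a \<in> A" "ereal e < (INF b\<in>B. ereal (norm (a - b)))"
    using assms unfolding hausdorff_semidist_def by (auto simp: less_SUP_iff)
  have "e < norm (a - b)" if "b \<in> B" for b
    using less_le_trans[OF a(2) INF_lower[OF that]] by simp
  with a(1) show ?thesis using that by blast
qed

lemma pullback_attractor_mem:
  "pullback_attractor \<Omega>1 \<theta>1 P \<theta>2 \<Phi> \<D> A \<Longrightarrow> A \<in> \<D>"
  unfolding pullback_attractor_def by (elim conjE)

lemma pullback_attractor_attracts:
  assumes "pullback_attractor \<Omega>1 \<theta>1 P \<theta>2 \<Phi> \<D> A" "B \<in> \<D>" "\<omega>1 \<in> \<Omega>1" "\<omega>2 \<in> space P"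
  shows "((\<lambda>t. hausdorff_semidist
            (\<Phi> t (\<theta>1 (- t) \<omega>1) (\<theta>2 (- t) \<omega>2) ` B (\<theta>1 (- t) \<omega>1, \<theta>2 (- t) \<omega>2))
            (A (\<omega>1, \<omega>2))) \<longlongrightarrow> 0) at_top"
  using assms(1)[unfolded pullback_attractor_def, THEN conjunct2, THEN conjunct2, THEN conjunct2,
      THEN conjunct2, rule_format, OF assms(2-4)] .

text \<open>Invariance, stated forward in time, is applied at the parameters shifted back by
  \<open>t\<close>; the two shifts then cancel.\<close>

lemma attractor_pullback_eq:
  assumes "parametric_flow \<Omega>1 \<theta>1" "parametric_flow (space P) \<theta>2"
    and "pullback_attractor \<Omega>1 \<theta>1 P \<theta>2 \<Phi> \<D> A"
    and "\<omega>1 \<in> \<Omega>1" "\<omega>2 \<in> space P" "t \<ge> 0"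
  shows "\<Phi> t (\<theta>1 (- t) \<omega>1) (\<theta>2 (- t) \<omega>2) ` A (\<theta>1 (- t) \<omega>1, \<theta>2 (- t) \<omega>2) = A (\<omega>1, \<omega>2)"
proof -
  have "\<theta>1 (- t) \<omega>1 \<in> \<Omega>1" "\<theta>2 (- t) \<omega>2 \<in> space P"
    using assms by (auto intro: parametric_flow_in)
  then have "\<Phi> t (\<theta>1 (- t) \<omega>1) (\<theta>2 (- t) \<omega>2) ` A (\<theta>1 (- t) \<omega>1, \<theta>2 (- t) \<omega>2)
      = A (\<theta>1 t (\<theta>1 (- t) \<omega>1), \<theta>2 t (\<theta>2 (- t) \<omega>2))"
    using assms(3,6) unfolding pullback_attractor_def by blast
  then show ?thesis
    using assms by (simp add: parametric_flow_cancel)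
qed

text \<open>The attractor belongs to \<open>\<D>\<close>, so \<open>K\<close> absorbs it. Its
  pulled-back images all equal \<open>A (\<omega>1, \<omega>2)\<close>, so one absorption time
  suffices.\<close>

lemma attractor_subset_absorbing:
  assumes "parametric_flow \<Omega>1 \<theta>1" "parametric_flow (space P) \<theta>2"
    and attr: "pullback_attractor \<Omega>1 \<theta>1 P \<theta>2 \<Phi> \<D> A"
    and abs: "pullback_absorbing \<Omega>1 \<theta>1 P \<theta>2 \<Phi> \<D> K"
    and "\<omega>1 \<in> \<Omega>1" "\<omega>2 \<in> space P"
  shows "A (\<omega>1, \<omega>2) \<subseteq> K (\<omega>1, \<omega>2)"
proof -
  obtain T where "T > 0"
    and "\<forall>t\<ge>T. \<Phi> t (\<theta>1 (- t) \<omega>1) (\<theta>2 (- t) \<omega>2) ` A (\<theta>1 (- t) \<omega>1, \<theta>2 (- t) \<omega>2) \<subseteq> K (\<omega>1, \<omega>2)"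
    using abs[unfolded pullback_absorbing_def, THEN conjunct2, rule_format,
        OF assms(5,6) pullback_attractor_mem[OF attr]] by (elim exE conjE)
  then have "\<Phi> T (\<theta>1 (- T) \<omega>1) (\<theta>2 (- T) \<omega>2) ` A (\<theta>1 (- T) \<omega>1, \<theta>2 (- T) \<omega>2) \<subseteq> K (\<omega>1, \<omega>2)"
    by simp
  then show ?thesis using attractor_pullback_eq[OF assms(1-3,5,6), of T] \<open>T > 0\<close> by simp
qed

theorem theorem3p1:
  fixes \<Omega>1 :: "'a set" and \<theta>1 :: "real \<Rightarrow> 'a \<Rightarrow> 'a"
    and P :: "'b measure" and \<theta>2 :: "real \<Rightarrow> 'b \<Rightarrow> 'b"
    and l0 :: "'l::metric_space"
    and \<Phi> :: "'l \<Rightarrow> real \<Rightarrow> 'a \<Rightarrow> 'b \<Rightarrow> 'x::banach \<Rightarrow> 'x"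
    and \<D> :: "'l \<Rightarrow> ('a \<times> 'b \<Rightarrow> 'x set) set"
    and A K :: "'l \<Rightarrow> 'a \<times> 'b \<Rightarrow> 'x set"
    and R :: "'a \<times> 'b \<Rightarrow> real"
  assumes separable: "separable_space (euclidean :: 'x topology)"
    and flow1: "parametric_flow \<Omega>1 \<theta>1"
    and flow2: "measurable_flow P \<theta>2"
    and cocycle: "\<And>l. continuous_cocycle \<Omega>1 \<theta>1 P \<theta>2 (\<Phi> l)"
    and families: "\<And>l. \<D> l \<subseteq> nonempty_families \<Omega>1 (space P)"
    and attractor: "\<And>l. pullback_attractor \<Omega>1 \<theta>1 P \<theta>2 (\<Phi> l) (\<D> l) (A l)"
    and absorbing: "\<And>l. pullback_absorbing \<Omega>1 \<theta>1 P \<theta>2 (\<Phi> l) (\<D> l) (K l)"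
    and convergence: "\<And>t \<omega>1 \<omega>2 ls xs x. t \<ge> 0 \<Longrightarrow> \<omega>1 \<in> \<Omega>1 \<Longrightarrow> \<omega>2 \<in> space P \<Longrightarrow>
       ls \<longlonglongrightarrow> l0 \<Longrightarrow> xs \<longlonglongrightarrow> x \<Longrightarrow>
       (\<lambda>n. \<Phi> (ls n) t \<omega>1 \<omega>2 (xs n)) \<longlonglongrightarrow> \<Phi> l0 t \<omega>1 \<omega>2 x"
    and ball_family: "(\<lambda>\<omega> \<in> \<Omega>1 \<times> space P. {x. norm x \<le> R \<omega>}) \<in> \<D> l0"
    and limsup_bound: "\<And>\<omega>1 \<omega>2. \<omega>1 \<in> \<Omega>1 \<Longrightarrow> \<omega>2 \<in> space P \<Longrightarrow>
       Limsup (at l0) (\<lambda>l. set_norm (K l (\<omega>1, \<omega>2))) \<le> ereal (R (\<omega>1, \<omega>2))"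
    and precompact: "\<And>\<omega>1 \<omega>2. \<omega>1 \<in> \<Omega>1 \<Longrightarrow> \<omega>2 \<in> space P \<Longrightarrow>
       compact (closure (\<Union>l. A l (\<omega>1, \<omega>2)))"
  shows "\<forall>\<omega>1\<in>\<Omega>1. \<forall>\<omega>2\<in>space P.
     ((\<lambda>l. hausdorff_semidist (A l (\<omega>1, \<omega>2)) (A l0 (\<omega>1, \<omega>2))) \<longlongrightarrow> 0) (at l0)"
proof (intro ballI)
  fix \<omega>1 \<omega>2 assume \<omega>: "\<omega>1 \<in> \<Omega>1" "\<omega>2 \<in> space P"
  have flow2': "parametric_flow (space P) \<theta>2"
    using flow2 unfolding measurable_flow_def by blast
  define h where "h l = hausdorff_semidist (A l (\<omega>1, \<omega>2)) (A l0 (\<omega>1, \<omega>2))" for l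
  have nonneg: "0 \<le> h l" for l
  proof -
    have "A l \<in> nonempty_families \<Omega>1 (space P)"
      using families pullback_attractor_mem[OF attractor] by (rule subsetD)
    then have "A l (\<omega>1, \<omega>2) \<noteq> {}"
      using \<omega> unfolding nonempty_families_def by (auto dest: PiE_mem)
    then show ?thesis unfolding h_def by (rule hausdorff_semidist_nonneg)
  qed
  have close: "\<forall>\<^sub>F l in at l0. h l < c" if "0 < c" for c
  proof (rule ccontr)
    assume far: "\<not> (\<forall>\<^sub>F l in at l0. h l < c)"
    \<comment> \<open>The bound \<open>c\<close> is an extended real and may be infinite; a real
      threshold below it can be compared with norms.\<close>
    obtain e where e: "0 < ereal e" "ereal e < c"
      using ereal_dense2[OF \<open>0 < c\<close>] by blast
    \<comment> \<open>The radii force the chosen parameters to converge to \<open>l0\<close>.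
      Keeping them distinct from \<open>l0\<close> allows the limsup bound, taken over a punctured
      neighbourhood, to be used along the sequence.\<close>
    have "\<exists>l x. l \<noteq> l0 \<and> dist l l0 < 1 / real (Suc n) \<and> x \<in> A l (\<omega>1, \<omega>2) \<and>
        (\<forall>b \<in> A l0 (\<omega>1, \<omega>2). e < norm (x - b))" for n
    proof -
      have "1 / real (Suc n) > 0" by simp
      then obtain l where l: "l \<noteq> l0" "dist l l0 < 1 / real (Suc n)" "\<not> h l < c"
        using far unfolding eventually_at by blast
      then have "ereal e < h l" using e(2) by simp
      then show ?thesis
        unfolding h_def using l by (metis less_hausdorff_semidistD)
    qed
    then obtain ls xs where ls: "\<And>n. ls n \<noteq> l0" "\<And>n. dist (ls n) l0 < 1 / real (Suc n)"
      and xs: "\<And>n. xs n \<in> A (ls n) (\<omega>1, \<omega>2)"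
      and xs_far: "\<And>n b. b \<in> A l0 (\<omega>1, \<omega>2) \<Longrightarrow> e < norm (xs n - b)"
      by metis
    have "(\<lambda>n. dist (ls n) l0) \<longlonglongrightarrow> 0"
      by (rule tendsto_sandwich[OF _ _ tendsto_const LIMSEQ_Suc[OF lim_1_over_n]])
        (use ls(2) in \<open>simp_all add: less_imp_le\<close>)
    then have ls_lim: "ls \<longlonglongrightarrow> l0" by (rule iffD2[OF tendsto_dist_iff])
    then have ls_at: "filterlim ls (at l0) sequentially"
      using ls(1) by (simp add: filterlim_at)
    have "\<forall>n. xs n \<in> closure (\<Union>l. A l (\<omega>1, \<omega>2))"
      by (rule allI, rule subsetD[OF closure_subset], rule UN_I[OF UNIV_I], rule xs)
    then obtain x r where "x \<in> closure (\<Union>l. A l (\<omega>1, \<omega>2))"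
      and r: "strict_mono (r :: nat \<Rightarrow> nat)" and x: "(xs \<circ> r) \<longlonglongrightarrow> x"
      by (rule seq_compactE[OF compact_imp_seq_compact[OF precompact[OF \<omega>]]])
    \<comment> \<open>The strict bound weakens in the limit, but still contradicts a distance
      strictly below \<open>e\<close>.\<close>
    have x_far: "e \<le> norm (x - b)" if "b \<in> A l0 (\<omega>1, \<omega>2)" for b
    proof (rule tendsto_lowerbound)
      show "(\<lambda>n. norm ((xs \<circ> r) n - b)) \<longlonglongrightarrow> norm (x - b)"
        by (intro tendsto_intros x)
    qed (use xs_far[OF that] in \<open>auto intro!: always_eventually less_imp_le\<close>)
    let ?B = "\<lambda>\<omega> \<in> \<Omega>1 \<times> space P. {x. norm x \<le> R \<omega>}"
    have "((\<lambda>t. hausdorff_semidist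
            (\<Phi> l0 t (\<theta>1 (- t) \<omega>1) (\<theta>2 (- t) \<omega>2) ` ?B (\<theta>1 (- t) \<omega>1, \<theta>2 (- t) \<omega>2))
            (A l0 (\<omega>1, \<omega>2))) \<longlongrightarrow> 0) at_top"
      using attractor ball_family \<omega> by (rule pullback_attractor_attracts)
    \<comment> \<open>A single pullback time \<open>t\<close> is fixed here, before any preimages
      are chosen; it depends only on \<open>e\<close> and the limit system.\<close>
    from eventually_conj[OF order_tendstoD(2)[OF this e(1)] eventually_ge_at_top[of 0]]
    obtain t where t: "t \<ge> 0" and attracted: "hausdorff_semidist
            (\<Phi> l0 t (\<theta>1 (- t) \<omega>1) (\<theta>2 (- t) \<omega>2) ` ?B (\<theta>1 (- t) \<omega>1, \<theta>2 (- t) \<omega>2))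
            (A l0 (\<omega>1, \<omega>2)) < ereal e"
      by (auto simp: eventually_at_top_linorder)
    define \<eta>1 \<eta>2 where "\<eta>1 = \<theta>1 (- t) \<omega>1" and "\<eta>2 = \<theta>2 (- t) \<omega>2"
    have \<eta>: "\<eta>1 \<in> \<Omega>1" "\<eta>2 \<in> space P"
      unfolding \<eta>1_def \<eta>2_def using flow1 flow2' \<omega> by (auto intro: parametric_flow_in)
    have "\<exists>y. y \<in> A (ls n) (\<eta>1, \<eta>2) \<and> \<Phi> (ls n) t \<eta>1 \<eta>2 y = xs n" for n
    proof -
      have "xs n \<in> \<Phi> (ls n) t \<eta>1 \<eta>2 ` A (ls n) (\<eta>1, \<eta>2)"
        unfolding \<eta>1_def \<eta>2_def attractor_pullback_eq[OF flow1 flow2' attractor \<omega> t] by (rule xs)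
      then show ?thesis by (elim imageE) auto
    qed
    then obtain ys where ys: "\<And>n. ys n \<in> A (ls n) (\<eta>1, \<eta>2)"
      and \<Phi>_ys: "\<And>n. \<Phi> (ls n) t \<eta>1 \<eta>2 (ys n) = xs n"
      by metis
    \<comment> \<open>The second extraction is made inside the first, so that the images along
      \<open>r \<circ> q\<close> still converge to \<open>x\<close>.\<close>
    have "\<forall>n. (ys \<circ> r) n \<in> closure (\<Union>l. A l (\<eta>1, \<eta>2))"
      unfolding o_apply by (rule allI, rule subsetD[OF closure_subset], rule UN_I[OF UNIV_I], rule ys)
    then obtain y q where "y \<in> closure (\<Union>l. A l (\<eta>1, \<eta>2))"
      and q: "strict_mono (q :: nat \<Rightarrow> nat)" and y: "((ys \<circ> r) \<circ> q) \<longlonglongrightarrow> y"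
      by (rule seq_compactE[OF compact_imp_seq_compact[OF precompact[OF \<eta>]]])
    define s where "s = r \<circ> q"
    have s: "strict_mono s" unfolding s_def using r q by (rule strict_mono_o)
    have y': "(\<lambda>n. ys (s n)) \<longlonglongrightarrow> y" using y by (simp add: s_def o_def)
    have "(\<lambda>n. \<Phi> (ls (s n)) t \<eta>1 \<eta>2 (ys (s n))) \<longlonglongrightarrow> \<Phi> l0 t \<eta>1 \<eta>2 y"
      using LIMSEQ_subseq_LIMSEQ[OF ls_lim s] y' by (intro convergence t \<eta>) (simp_all add: o_def)
    moreover have "(\<lambda>n. \<Phi> (ls (s n)) t \<eta>1 \<eta>2 (ys (s n))) \<longlonglongrightarrow> x"
      using LIMSEQ_subseq_LIMSEQ[OF x q] by (simp add: \<Phi>_ys s_def o_def)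
    ultimately have x_eq: "\<Phi> l0 t \<eta>1 \<eta>2 y = x" by (rule LIMSEQ_unique)
    have "norm y \<le> R (\<eta>1, \<eta>2)"
    \<comment> \<open>The limsup bound is not strict, so the norms of \<open>ys\<close> are only
      eventually below \<open>R (\<eta>1, \<eta>2) + d\<close> for each positive \<open>d\<close>;
      the slack vanishes after passing to the limit \<open>y\<close>.\<close>
    proof (rule field_le_epsilon)
      fix d :: real assume "0 < d"
      have "Limsup (at l0) (\<lambda>l. set_norm (K l (\<eta>1, \<eta>2))) < ereal (R (\<eta>1, \<eta>2) + d)"
        by (rule le_less_trans[OF limsup_bound[OF \<eta>]]) (use \<open>0 < d\<close> in simp)
      then have "\<forall>\<^sub>F l in at l0. set_norm (K l (\<eta>1, \<eta>2)) < ereal (R (\<eta>1, \<eta>2) + d)"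
        by (rule Limsup_lessD)
      then have "\<forall>\<^sub>F n in sequentially. set_norm (K (ls n) (\<eta>1, \<eta>2)) < ereal (R (\<eta>1, \<eta>2) + d)"
        using ls_at by (rule eventually_compose_filterlim)
      then have "\<forall>\<^sub>F n in sequentially. norm (ys n) \<le> R (\<eta>1, \<eta>2) + d"
      proof eventually_elim
        case (elim n)
        have "ys n \<in> K (ls n) (\<eta>1, \<eta>2)"
          using attractor_subset_absorbing[OF flow1 flow2' attractor absorbing \<eta>] ys
          by (rule subsetD)
        from le_less_trans[OF norm_le_set_norm[OF this] elim] show ?case by simp
      qed
      then have "\<forall>\<^sub>F n in sequentially. norm (ys (s n)) \<le> R (\<eta>1, \<eta>2) + d"
        by (rule eventually_subseq[OF s])
      then show "norm y \<le> R (\<eta>1, \<eta>2) + d"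
        using tendsto_norm[OF y'] by (intro tendsto_upperbound) auto
    qed
    \<comment> \<open>Thus \<open>x\<close> lies in the image of the ball at the shifted parameters,
      the very set that is within \<open>e\<close> of the attractor at time
      \<open>t\<close>.\<close>
    then have "x \<in> \<Phi> l0 t \<eta>1 \<eta>2 ` ?B (\<eta>1, \<eta>2)"
      using x_eq \<eta> by auto
    with attracted obtain b where "b \<in> A l0 (\<omega>1, \<omega>2)" "norm (x - b) < e"
      unfolding \<eta>1_def \<eta>2_def by (rule hausdorff_semidist_lessD)
    with x_far show False by fastforce
  qed
  show "((\<lambda>l. hausdorff_semidist (A l (\<omega>1, \<omega>2)) (A l0 (\<omega>1, \<omega>2))) \<longlongrightarrow> 0) (at l0)"
    unfolding h_def[symmetric]
    by (rule order_tendstoI) (use nonneg close in \<open>auto intro: less_le_trans always_eventually\<close>)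
qed

end
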